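(* Fix $\varepsilon>0$. Let $h:\Theta\to\mathbb{R}$ be an interior equilibrium of the market described in the context. Then $h$ is fully revealing: for all $\theta,\theta'\in\Theta$, $\theta\neq\theta'$ implies $h(\theta)\neq h(\theta')$.
   Context: Primitives: $\Theta=\Theta_1\times\cdots\times\Theta_n$ is a finite set of states; $\mu$ is a full-support probability distribution on $\Theta$; $S:\Theta\to(0,\infty)$ is one-to-one; $c$ is a real cost; $v^*$ is a real number with $v^*-c>0$. Supply: there is a measure one of firms with types $\pi\sim U[0,1]$. At state $\theta$ and price $\phi$, a type-$\pi$ firm is active iff $\phi-c+\pi S(\theta)\ge 0$. Let $\pi^\star(\theta,\phi)=(c-\phi)/S(\theta)$ be the value of $\pi$ making this an equality. When $\pi^\star(\theta,\phi)\in[0,1]$, total supply is $1-\pi^\star(\theta,\phi)$. The add-on $q=\pi S(\theta)$ among active firms is then distributed, given $(\theta,\phi)$, uniformly on $[\pi^\star(\theta,\phi)S(\theta),S(\theta)]$. Demand: $\mathcal{M}$ is a finite nonempty collection of subsets $M\subseteq\{1,\dots,n\}$ (cognitive types). For each $M\in\mathcal{M}$ there is a measure greater than one of type-$M$ consumers. Consumers' bare valuations $v$ are distributed continuously over $[v^*-\varepsilon,v^*+\varepsilon]$. For $M\subseteq\{1,\dots,n\}$ write $\theta_M=(\theta_i)_{i\in M}$. A function $h:\Theta\to\mathbb{R}$ (price as a function of the state), together with $\mu$ and the conditional distribution of $q$ given $(\theta,\phi)$ that is uniform on $[\pi^\star(\theta,\phi)S(\theta),S(\theta)]$, induces a joint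 probability distribution $p$ over $(\theta,\phi,q)$ with $p(\theta)=\mu(\theta)$ and $p(\phi=h(\theta)\mid\theta)=1$. Given $p$, a type-$M$ consumer who observes a price $\phi$ of positive probability has the belief $p_M(q\mid\phi)=\sum_{\theta_M}p(\theta_M\mid\phi)\,p(q\mid\theta_M)$ about $q$. Let $E_M(q\mid\phi)$ be its expectation. A type-$M$ consumer with valuation $v$ buys at price $\phi$ iff $v\ge\phi+E_M(q\mid\phi)$. Total demand at $\phi$ is the total measure (over all $M\in\mathcal{M}$) of consumers who buy. Equilibrium: $h$ is a competitive equilibrium if for every $\theta$, total supply at $(\theta,h(\theta))$ equals total demand at $h(\theta)$ induced by $p$. It is interior if $\pi^\star(\theta,h(\theta))\in(0,1)$ for every $\theta$. *)

theory Defs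
  imports "HOL-Probability.Probability"
begin

(* States are dependent functions on {1..n}; all components share one ambient type 'a, and the
   component sets Th i may differ.  Only the values of S and h on the state space matter. *)

definition state_space :: "nat \<Rightarrow> (nat \<Rightarrow> 'a set) \<Rightarrow> (nat \<Rightarrow> 'a) set" where
  "state_space n Th = Pi\<^sub>E {1..n} Th"

definition active :: "('s \<Rightarrow> real) \<Rightarrow> real \<Rightarrow> 's \<Rightarrow> real \<Rightarrow> real \<Rightarrow> bool" where
  "active S c \<theta> \<phi> \<pi> \<longleftrightarrow> \<phi> - c + \<pi> * S \<theta> \<ge> 0"

definition cutoff :: "('s \<Rightarrow> real) \<Rightarrow> real \<Rightarrow> 's \<Rightarrow> real \<Rightarrow> real" where
  "cutoff S c \<theta> \<phi> = (c - \<phi>) / S \<theta>"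

definition total_supply :: "('s \<Rightarrow> real) \<Rightarrow> real \<Rightarrow> 's \<Rightarrow> real \<Rightarrow> real" where
  "total_supply S c \<theta> \<phi> = measure (uniform_measure lborel {0..1}) {\<pi>. active S c \<theta> \<phi> \<pi>}"

definition addon_dist :: "('s \<Rightarrow> real) \<Rightarrow> real \<Rightarrow> 's \<Rightarrow> real \<Rightarrow> real measure" where
  "addon_dist S c \<theta> \<phi> = uniform_measure lborel {cutoff S c \<theta> \<phi> * S \<theta> .. S \<theta>}"

(* The joint law p of (state, price, add-on).  It is a probability measure when every cutoff is
   below 1 (see prob_space_joint); a cutoff of at least 1 makes the interval in addon_dist
   degenerate. *)

definition joint :: "'s pmf \<Rightarrow> ('s \<Rightarrow> real) \<Rightarrow> real \<Rightarrow> ('s \<Rightarrow> real) \<Rightarrow> ('s \<times> real \<times> real) measure" where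
  "joint \<mu> S c h =
     measure_pmf \<mu> \<bind>
       (\<lambda>\<theta>. distr (addon_dist S c \<theta> (h \<theta>)) (count_space UNIV \<Otimes>\<^sub>M borel \<Otimes>\<^sub>M borel)
              (\<lambda>q. (\<theta>, h \<theta>, q)))"

(* belief p Th M \<phi> is the law
     p_M(q | \<phi>) = sum over \<theta>_M of p(\<theta>_M | \<phi>) * p(q | \<theta>_M);
   the second factor conditions on \<theta>_M only, not on the price.  The projection \<theta>_M is
   restrict \<theta> M.  Conditional probabilities given null events are 0 here. *)

definition belief ::
  "((nat \<Rightarrow> 'a) \<times> real \<times> real) measure \<Rightarrow> (nat \<Rightarrow> 'a set) \<Rightarrow> nat set \<Rightarrow> real \<Rightarrow> real measure" where
  "belief p Th M \<phi> = measure_of UNIV (sets borel)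
     (\<lambda>B. ennreal (\<Sum>t\<in>Pi\<^sub>E M Th.
        \<P>((\<theta>, x, q) in p. restrict \<theta> M = t \<bar> x = \<phi>) *
        \<P>((\<theta>, x, q) in p. q \<in> B \<bar> restrict \<theta> M = t)))"

definition expected_addon ::
  "((nat \<Rightarrow> 'a) \<times> real \<times> real) measure \<Rightarrow> (nat \<Rightarrow> 'a set) \<Rightarrow> nat set \<Rightarrow> real \<Rightarrow> real" where
  "expected_addon p Th M \<phi> = (\<integral>q. q \<partial>belief p Th M \<phi>)"

(* mass M is the measure of type-M consumers, F M the probability law of their bare valuations. *)

definition total_demand ::
  "((nat \<Rightarrow> 'a) \<times> real \<times> real) measure \<Rightarrow> (nat \<Rightarrow> 'a set) \<Rightarrow> nat set set \<Rightarrow>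
   (nat set \<Rightarrow> real) \<Rightarrow> (nat set \<Rightarrow> real measure) \<Rightarrow> real \<Rightarrow> real" where
  "total_demand p Th \<M> mass F \<phi> =
     (\<Sum>M\<in>\<M>. mass M * measure (F M) {v. v \<ge> \<phi> + expected_addon p Th M \<phi>})"

definition competitive_equilibrium ::
  "nat \<Rightarrow> (nat \<Rightarrow> 'a set) \<Rightarrow> (nat \<Rightarrow> 'a) pmf \<Rightarrow> ((nat \<Rightarrow> 'a) \<Rightarrow> real) \<Rightarrow> real \<Rightarrow>
   nat set set \<Rightarrow> (nat set \<Rightarrow> real) \<Rightarrow> (nat set \<Rightarrow> real measure) \<Rightarrow> ((nat \<Rightarrow> 'a) \<Rightarrow> real) \<Rightarrow> bool" where
  "competitive_equilibrium n Th \<mu> S c \<M> mass F h \<longleftrightarrow>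
     (\<forall>\<theta>\<in>state_space n Th.
        total_supply S c \<theta> (h \<theta>) = total_demand (joint \<mu> S c h) Th \<M> mass F (h \<theta>))"

definition interior_cutoffs ::
  "nat \<Rightarrow> (nat \<Rightarrow> 'a set) \<Rightarrow> ((nat \<Rightarrow> 'a) \<Rightarrow> real) \<Rightarrow> real \<Rightarrow> ((nat \<Rightarrow> 'a) \<Rightarrow> real) \<Rightarrow> bool" where
  "interior_cutoffs n Th S c h \<longleftrightarrow> (\<forall>\<theta>\<in>state_space n Th. cutoff S c \<theta> (h \<theta>) \<in> {0<..<1})"

definition fully_revealing ::
  "nat \<Rightarrow> (nat \<Rightarrow> 'a set) \<Rightarrow> ((nat \<Rightarrow> 'a) \<Rightarrow> real) \<Rightarrow> bool" where
  "fully_revealing n Th h \<longleftrightarrow>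
     (\<forall>\<theta>\<in>state_space n Th. \<forall>\<theta>'\<in>state_space n Th. \<theta> \<noteq> \<theta>' \<longrightarrow> h \<theta> \<noteq> h \<theta>')"

(* An atomless law concentrated on [a, b]. *)

definition continuous_law_on :: "real \<Rightarrow> real \<Rightarrow> real measure \<Rightarrow> bool" where
  "continuous_law_on a b F \<longleftrightarrow>
     real_distribution F \<and> continuous_on UNIV (cdf F) \<and> measure F {a..b} = 1"


lemma subprob_space_addon_dist: "subprob_space (addon_dist S c \<theta> \<phi>)"
proof -
  let ?I = "{cutoff S c \<theta> \<phi> * S \<theta> .. S \<theta>}"
  have fin: "emeasure lborel ?I \<noteq> \<infinity>"
    by (cases "cutoff S c \<theta> \<phi> * S \<theta> \<le> S \<theta>") auto
  show ?thesis
  proof (cases "emeasure lborel ?I = 0")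
    case True
    have "emeasure (addon_dist S c \<theta> \<phi>) UNIV \<le> 1"
    proof -
      have "AE x in lborel. x \<notin> ?I"
        using True by (intro AE_not_in) (auto simp: null_sets_def)
      then have "AE x in lborel. indicator ?I x / emeasure lborel ?I = 0"
        by (rule eventually_mono) (metis indicator_simps(2) ennreal_zero_divide)
      then have "(\<integral>\<^sup>+x. indicator ?I x / emeasure lborel ?I \<partial>lborel) = 0"
        by (subst nn_integral_0_iff_AE) auto
      then have "emeasure (addon_dist S c \<theta> \<phi>) UNIV = 0"
        unfolding addon_dist_def uniform_measure_def by (subst emeasure_density) auto
      then show ?thesis by simp
    qed
    then show ?thesis
      by (intro subprob_spaceI) (auto simp: addon_dist_def)
  next
    case False
    then show ?thesis
      unfolding addon_dist_def using fin
      by (intro prob_space_imp_subprob_space prob_space_uniform_measure) auto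
  qed
qed

lemma prob_space_addon_dist:
  assumes "cutoff S c \<theta> \<phi> < 1" "S \<theta> > 0"
  shows "prob_space (addon_dist S c \<theta> \<phi>)"
proof -
  have "cutoff S c \<theta> \<phi> * S \<theta> < S \<theta>" using assms by simp
  then show ?thesis
    unfolding addon_dist_def by (intro prob_space_uniform_measure) auto
qed

lemma measurable_joint_kernel:
  "(\<lambda>\<theta>. distr (addon_dist S c \<theta> (h \<theta>)) (count_space UNIV \<Otimes>\<^sub>M borel \<Otimes>\<^sub>M borel) (\<lambda>q. (\<theta>, h \<theta>, q)))
     \<in> measurable (measure_pmf \<mu>) (subprob_algebra (count_space UNIV \<Otimes>\<^sub>M borel \<Otimes>\<^sub>M borel))"
proof -
  have m: "(\<lambda>q. (\<theta>, h \<theta>, q)) \<in> addon_dist S c \<theta> (h \<theta>) \<rightarrow>\<^sub>M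
     count_space UNIV \<Otimes>\<^sub>M borel \<Otimes>\<^sub>M (borel :: real measure)" for \<theta>
    by (simp add: addon_dist_def)
  show ?thesis
    by (auto simp: space_subprob_algebra space_pair_measure
          intro!: subprob_space.subprob_space_distr subprob_space_addon_dist m)
qed

lemma sets_joint:
  "sets (joint \<mu> S c h) = sets (count_space UNIV \<Otimes>\<^sub>M borel \<Otimes>\<^sub>M borel)"
  unfolding joint_def by (intro sets_bind[OF sets_kernel[OF measurable_joint_kernel]]) auto

lemma space_joint: "space (joint \<mu> S c h) = UNIV"
  using sets_eq_imp_space_eq[OF sets_joint, of \<mu> S c h] by (simp add: space_pair_measure)

lemma prob_space_joint:
  assumes "\<And>\<theta>. \<theta> \<in> set_pmf \<mu> \<Longrightarrow> S \<theta> > 0 \<and> cutoff S c \<theta> (h \<theta>) < 1"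
  shows "prob_space (joint \<mu> S c h)"
  unfolding joint_def
proof (rule prob_space.prob_space_bind[OF measure_pmf.prob_space_axioms _ measurable_joint_kernel])
  show "AE \<theta> in measure_pmf \<mu>. prob_space
     (distr (addon_dist S c \<theta> (h \<theta>)) (count_space UNIV \<Otimes>\<^sub>M borel \<Otimes>\<^sub>M borel) (\<lambda>q. (\<theta>, h \<theta>, q)))"
    using assms
    by (auto simp: AE_measure_pmf_iff addon_dist_def[symmetric]
          intro!: prob_space.prob_space_distr prob_space_addon_dist)
       (auto simp: addon_dist_def)
qed

lemma sets_belief [simp]: "sets (belief p Th M \<phi>) = sets borel"
proof -
  have "sigma_sets UNIV (sets borel) = sets (borel :: real measure)"
    using sets.sigma_sets_eq[of "borel :: real measure"] by simp
  then show ?thesis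
    unfolding belief_def by simp
qed

lemma emeasure_belief:
  assumes p: "prob_space p" "sets p = sets (count_space UNIV \<Otimes>\<^sub>M borel \<Otimes>\<^sub>M borel)"
    and B: "B \<in> sets borel"
  shows "emeasure (belief p Th M \<phi>) B =
     ennreal (\<Sum>t\<in>Pi\<^sub>E M Th.
        \<P>((\<theta>, x, q) in p. restrict \<theta> M = t \<bar> x = \<phi>) *
        \<P>((\<theta>, x, q) in p. q \<in> B \<bar> restrict \<theta> M = t))"
proof -
  interpret prob_space p by fact
  note [measurable_cong] = p(2)
  have sp: "space p = UNIV"
    using sets_eq_imp_space_eq[OF p(2)] by (simp add: space_pair_measure)
  define A where "A t = {(\<theta>, x :: real, q :: real). restrict \<theta> M = t}" for t :: "nat \<Rightarrow> 'a"
  define C where "C B = {(\<theta> :: nat \<Rightarrow> 'a, x :: real, q). q \<in> B}" for B :: "real set"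
  define w where "w t = \<P>((\<theta>, x, q) in p. restrict \<theta> M = t \<bar> x = \<phi>)" for t
  have U: "(UNIV :: (real \<times> real) set) \<in> sets (borel \<Otimes>\<^sub>M borel)"
    using sets.top[of "borel \<Otimes>\<^sub>M borel :: (real \<times> real) measure"]
    by (simp add: space_pair_measure)
  have A: "A t \<in> sets p" for t
  proof -
    have "A t = {\<theta>. restrict \<theta> M = t} \<times> UNIV" by (auto simp: A_def)
    then show ?thesis unfolding p(2) using U by (auto intro!: pair_measureI)
  qed
  have C: "C B \<in> sets p" if "B \<in> sets borel" for B
  proof -
    have "C B = UNIV \<times> UNIV \<times> B" by (auto simp: C_def)
    then show ?thesis unfolding p(2) using that by (auto intro!: pair_measureI)
  qed
  have cond: "\<P>((\<theta>, x, q) in p. q \<in> B \<bar> restrict \<theta> M = t) = prob (C B \<inter> A t) / prob (A t)" for B t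
    unfolding cond_prob_def sp
    by (intro arg_cong2[where f = "(/)"] arg_cong[where f = prob]) (auto simp: A_def C_def)
  have w0: "w t \<ge> 0" for t unfolding w_def cond_prob_def by simp
  have "emeasure (belief p Th M \<phi>) B =
      ennreal (\<Sum>t\<in>Pi\<^sub>E M Th. w t * (prob (C B \<inter> A t) / prob (A t)))"
  proof (rule emeasure_measure_of[where \<Omega> = UNIV and A = "sets borel"])
    show "belief p Th M \<phi> = measure_of UNIV (sets borel)
        (\<lambda>B. ennreal (\<Sum>t\<in>Pi\<^sub>E M Th. w t * (prob (C B \<inter> A t) / prob (A t))))"
      unfolding belief_def cond w_def ..
    show "positive (sets (belief p Th M \<phi>))
        (\<lambda>B. ennreal (\<Sum>t\<in>Pi\<^sub>E M Th. w t * (prob (C B \<inter> A t) / prob (A t))))"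
    proof -
      have "C {} = {}" by (auto simp: C_def)
      then show ?thesis by (simp add: positive_def)
    qed
    show "countably_additive (sets (belief p Th M \<phi>))
        (\<lambda>B. ennreal (\<Sum>t\<in>Pi\<^sub>E M Th. w t * (prob (C B \<inter> A t) / prob (A t))))"
    proof (rule countably_additiveI)
      fix D :: "nat \<Rightarrow> real set"
      assume D: "range D \<subseteq> sets (belief p Th M \<phi>)" "disjoint_family D"
        "(\<Union>i. D i) \<in> sets (belief p Th M \<phi>)"
      have "(\<lambda>i. prob (C (D i) \<inter> A t)) sums prob (\<Union>i. C (D i) \<inter> A t)" for t
        using D A C by (intro finite_measure_UNION) (auto simp: disjoint_family_on_def C_def)
      moreover have "(\<Union>i. C (D i) \<inter> A t) = C (\<Union>i. D i) \<inter> A t" for t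
        by (auto simp: C_def)
      ultimately have "(\<lambda>i. \<Sum>t\<in>Pi\<^sub>E M Th. w t * (prob (C (D i) \<inter> A t) / prob (A t))) sums
          (\<Sum>t\<in>Pi\<^sub>E M Th. w t * (prob (C (\<Union>i. D i) \<inter> A t) / prob (A t)))"
        by (intro sums_sum sums_mult sums_divide) simp
      then show "(\<Sum>i. ennreal (\<Sum>t\<in>Pi\<^sub>E M Th. w t * (prob (C (D i) \<inter> A t) / prob (A t)))) =
          ennreal (\<Sum>t\<in>Pi\<^sub>E M Th. w t * (prob (C (\<Union>i. D i) \<inter> A t) / prob (A t)))"
        by (intro suminf_ennreal_eq) (auto intro!: sum_nonneg divide_nonneg_nonneg mult_nonneg_nonneg w0)
    qed
  qed (use B in auto)
  then show ?thesis unfolding cond w_def .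
qed

lemma total_supply_eq:
  assumes "S \<theta> > 0" "cutoff S c \<theta> \<phi> \<in> {0..1}"
  shows "total_supply S c \<theta> \<phi> = 1 - cutoff S c \<theta> \<phi>"
proof -
  let ?k = "cutoff S c \<theta> \<phi>"
  have "active S c \<theta> \<phi> \<pi> \<longleftrightarrow> ?k \<le> \<pi>" for \<pi>
  proof -
    have "?k \<le> \<pi> \<longleftrightarrow> c - \<phi> \<le> \<pi> * S \<theta>"
      unfolding cutoff_def by (rule pos_divide_le_eq[OF assms(1)])
    then show ?thesis unfolding active_def by linarith
  qed
  then have act: "{\<pi>. active S c \<theta> \<phi> \<pi>} = {?k..}"
    by (simp add: atLeast_def)
  have k: "{0..1} \<inter> {?k..} = {?k..1}"
    using assms(2) by auto
  have "total_supply S c \<theta> \<phi> = measure lborel ({0..1} \<inter> {?k..}) / measure lborel {0..1::real}"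
    unfolding total_supply_def act by (rule measure_uniform_measure) auto
  also have "\<dots> = 1 - ?k"
    unfolding k using assms(2) by simp
  finally show ?thesis .
qed

end

theory Submission
  imports Defs
begin

text \<open>Total demand depends on the state only through the price, so two states with the same price
have the same supply, hence the same cutoff \<open>(c - \<phi>) / S \<theta>\<close>. An interior cutoff is nonzero,
so \<open>c \<noteq> \<phi>\<close> and the values of \<open>S\<close> agree.\<close>

theorem proposition1:
  fixes n :: nat and Th :: "nat \<Rightarrow> 'a set"
    and \<mu> :: "(nat \<Rightarrow> 'a) pmf" and S h :: "(nat \<Rightarrow> 'a) \<Rightarrow> real"
    and c vstar \<epsilon> :: real
    and \<M> :: "nat set set" and mass :: "nat set \<Rightarrow> real" and F :: "nat set \<Rightarrow> real measure"
  assumes "\<And>i. i \<in> {1..n} \<Longrightarrow> finite (Th i)"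
    and "set_pmf \<mu> = state_space n Th"
    and "\<And>\<theta>. \<theta> \<in> state_space n Th \<Longrightarrow> S \<theta> > 0"
    and "inj_on S (state_space n Th)"
    and "vstar - c > 0"
    and "finite \<M>" and "\<M> \<noteq> {}" and "\<And>M. M \<in> \<M> \<Longrightarrow> M \<subseteq> {1..n}"
    and "\<And>M. M \<in> \<M> \<Longrightarrow> mass M > 1"
    and "\<epsilon> > 0"
    and "\<And>M. M \<in> \<M> \<Longrightarrow> continuous_law_on (vstar - \<epsilon>) (vstar + \<epsilon>) (F M)"
    and "competitive_equilibrium n Th \<mu> S c \<M> mass F h"
    and "interior_cutoffs n Th S c h"
  shows "fully_revealing n Th h"
  unfolding fully_revealing_def
proof (intro ballI impI notI)
  fix \<theta> \<theta>'
  assume \<theta>: "\<theta> \<in> state_space n Th" and \<theta>': "\<theta>' \<in> state_space n Th"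
    and ne: "\<theta> \<noteq> \<theta>'" and eq: "h \<theta> = h \<theta>'"
  have pos: "S \<theta> > 0" "S \<theta>' > 0"
    using assms(3) \<theta> \<theta>' by auto
  have int: "cutoff S c \<theta> (h \<theta>) \<in> {0<..<1}" "cutoff S c \<theta>' (h \<theta>') \<in> {0<..<1}"
    using assms(13) \<theta> \<theta>' by (auto simp: interior_cutoffs_def)
  \<comment> \<open>The law \<open>joint \<mu> S c h\<close> is the same in both clearing
    conditions, so at the common price every type holds the same belief and buys the same amount,
    however beliefs are formed.\<close>
  have "total_supply S c \<theta> (h \<theta>) = total_supply S c \<theta>' (h \<theta>')"
    using assms(12) \<theta> \<theta>' eq unfolding competitive_equilibrium_def by metis
  \<comment> \<open>Interiority puts both cutoffs in the range where supply is one minus the cutoff,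
    with no truncation at 0 or 1.\<close>
  then have "cutoff S c \<theta> (h \<theta>) = cutoff S c \<theta>' (h \<theta>')"
    using pos int by (simp add: total_supply_eq)
  \<comment> \<open>The strict lower bound enters here: at price \<open>c\<close> every cutoff is 0,
    so equal cutoffs would not tell values of \<open>S\<close> apart.\<close>
  moreover have "c - h \<theta> \<noteq> 0"
    using int(1) by (auto simp: cutoff_def)
  ultimately have "S \<theta> = S \<theta>'"
    using pos eq by (simp add: cutoff_def field_simps)
  then show False
    using inj_onD[OF assms(4)] \<theta> \<theta>' ne by blast
qed

end
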